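(* Let $\mu$ be a directed distance on a finite set $S$. The following conditions are equivalent: (a) $\mu$ has an oriented-tree realization $(\Gamma,\alpha;\{F_s\}_{s\in S})$ such that $\Gamma$ is a directed path. (b) $\dim T_\mu\le 1$. (c) For all $s,t,u,v\in S$ (not necessarily distinct), $$\mu(s,u)+\mu(t,v)\le\max\{\mu(s,v)+\mu(t,u),\ \mu(s,u),\ \mu(s,v),\ \mu(t,u),\ \mu(t,v)\}.$$
   Context: A directed distance on a set $S$ is a function $\mu:S\times S\to\mathbf{R}_+$ (nonnegative reals) with $\mu(s,s)=0$ for all $s$; neither symmetry nor the triangle inequality is required. Let $S^c,S^r$ be two disjoint copies of $S$, with $s^c\in S^c$, $s^r\in S^r$ the copies of $s\in S$, and $S^{cr}=S^c\cup S^r$. Let $P_\mu=\{p\in\mathbf{R}_+^{S^{cr}} : p(s^c)+p(t^r)\ge\mu(s,t)\ \forall s,t\in S\}$, and let $T_\mu$ (the directed tight span) be the set of minimal elements of $P_\mu$, i.e. points $p\in P_\mu$ for which there is no $q\in P_\mu$, $q\ne p$, with $q\le p$ coordinatewise. $T_\mu$ is a union of faces of the polyhedron $P_\mu$, and $\dim T_\mu$ is its dimension as a polyhedral complex (the maximum dimension of a face of $P_\mu$ contained in $T_\mu$). An oriented tree is a (finite) directed graph whose underlying undirected graph is a tree. For an oriented tree $\Gamma$ with vertex set $V\Gamma$, edge set $E\Gamma$ and nonnegative edge-length $\alpha:E\Gamma\to\mathbf{R}_+$, and $x,y\in V\Gamma$, let $\vec P[x,y]$ be the set of those edges on the unique path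 between $x$ and $y$ in the underlying undirected tree whose direction agrees with the direction from $x$ to $y$, and set $D_{\Gamma,\alpha}(x,y)=\sum_{e\in\vec P[x,y]}\alpha(e)$. A subtree of $\Gamma$ is a (nonempty) subgraph whose underlying undirected graph is connected. For subtrees $F,F'$, $D_{\Gamma,\alpha}(F,F')$ is the minimum of $D_{\Gamma,\alpha}(x,y)$ over vertices $x$ of $F$ and $y$ of $F'$. An oriented-tree realization of $\mu$ is a triple $(\Gamma,\alpha;\{F_s\}_{s\in S})$ consisting of an oriented tree $\Gamma$, a positive edge-length $\alpha:E\Gamma\to\mathbf{R}_+$, and a family of subtrees $F_s$ $(s\in S)$ of $\Gamma$ with $\mu(s,t)=D_{\Gamma,\alpha}(F_s,F_t)$ for all $s,t\in S$. A directed path is an oriented tree each of whose vertices has at most one leaving edge and at most one entering edge. *)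

theory Defs
  imports "HOL-Analysis.Analysis" "Graph_Theory.Digraph_Component"
begin

section \<open>Directed distances and the directed tight span\<close>

definition directed_distance_on :: "'s set \<Rightarrow> ('s \<Rightarrow> 's \<Rightarrow> real) \<Rightarrow> bool" where
  "directed_distance_on S \<mu> \<longleftrightarrow> (\<forall>s\<in>S. \<forall>t\<in>S. 0 \<le> \<mu> s t) \<and> (\<forall>s\<in>S. \<mu> s s = 0)"

text \<open>
  The two disjoint copies of \<open>S\<close> are the summands of \<open>S <+> S\<close>: the element \<open>Inl s\<close> is
  the copy of \<open>s\<close> in \<open>S\<^sup>c\<close> and \<open>Inr s\<close> the one in \<open>S\<^sup>r\<close>. The space of real vectors
  indexed by \<open>S <+> S\<close> is represented as the subspace of \<open>real ^ ('s + 's)\<close> of the vectors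
  that vanish at all other indices. (Working with a subset of a finite type, rather than with
  the whole type, keeps the empty set \<open>S\<close>.)
\<close>

definition dist_polyhedron ::
    "'s::finite set \<Rightarrow> ('s \<Rightarrow> 's \<Rightarrow> real) \<Rightarrow> (real ^ ('s + 's)) set" where
  "dist_polyhedron S \<mu> =
    {p. (\<forall>i \<in> S <+> S. 0 \<le> p $ i) \<and> (\<forall>i. i \<notin> S <+> S \<longrightarrow> p $ i = 0) \<and>
        (\<forall>s\<in>S. \<forall>t\<in>S. \<mu> s t \<le> p $ Inl s + p $ Inr t)}"

text \<open>The order on \<open>real ^ 'n\<close> is the coordinatewise one.\<close>

definition directed_tight_span ::
    "'s::finite set \<Rightarrow> ('s \<Rightarrow> 's \<Rightarrow> real) \<Rightarrow> (real ^ ('s + 's)) set" where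
  "directed_tight_span S \<mu> =
    {p \<in> dist_polyhedron S \<mu>. \<not> (\<exists>q \<in> dist_polyhedron S \<mu>. q \<noteq> p \<and> q \<le> p)}"

definition dim_directed_tight_span :: "'s::finite set \<Rightarrow> ('s \<Rightarrow> 's \<Rightarrow> real) \<Rightarrow> int" where
  "dim_directed_tight_span S \<mu> =
    Max {aff_dim F | F. F face_of dist_polyhedron S \<mu> \<and> F \<subseteq> directed_tight_span S \<mu>}"


section \<open>Oriented trees\<close>

text \<open>
  \<open>Digraph_Component.tree\<close> only forbids directed cycles, so it is not the notion needed here.
  The underlying undirected graph is represented by \<open>mk_symmetric\<close>, which contains both
  \<open>(x, y)\<close> and \<open>(y, x)\<close> for each edge; in it, going along an edge and back is a \<open>cycle\<close> of
  length 2, and the cycles of the undirected graph are those of length at least 3.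
  Since \<open>mk_symmetric\<close> merges antiparallel edges, these are excluded separately.
\<close>

definition oriented_tree :: "'v pair_pre_digraph \<Rightarrow> bool" where
  "oriented_tree G \<longleftrightarrow>
    pair_digraph G \<and>
    (\<forall>x y. (x, y) \<in> parcs G \<longrightarrow> (y, x) \<notin> parcs G) \<and>
    Digraph_Component.connected (with_proj G) \<and>
    \<not> (\<exists>p. pre_digraph.cycle (with_proj (mk_symmetric (with_proj G))) p \<and> 3 \<le> length p)"

definition directed_path :: "'v pair_pre_digraph \<Rightarrow> bool" where
  "directed_path G \<longleftrightarrow>
    oriented_tree G \<and>
    (\<forall>v \<in> pverts G. out_degree (with_proj G) v \<le> 1 \<and> in_degree (with_proj G) v \<le> 1)"

text \<open>
  The edges of the unique path between \<open>x\<close> and \<open>y\<close> in the underlying undirected tree, each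
  written as a pair in the direction in which it is traversed from \<open>x\<close> to \<open>y\<close>.
\<close>

definition undirected_path :: "'v pair_pre_digraph \<Rightarrow> 'v \<Rightarrow> 'v \<Rightarrow> ('v \<times> 'v) list" where
  "undirected_path G x y =
    (THE p. pre_digraph.apath (with_proj (mk_symmetric (with_proj G))) x p y)"

definition forward_edges :: "'v pair_pre_digraph \<Rightarrow> 'v \<Rightarrow> 'v \<Rightarrow> ('v \<times> 'v) set" where
  "forward_edges G x y = set (undirected_path G x y) \<inter> parcs G"

definition tree_dist ::
    "'v pair_pre_digraph \<Rightarrow> ('v \<times> 'v \<Rightarrow> real) \<Rightarrow> 'v \<Rightarrow> 'v \<Rightarrow> real" where
  "tree_dist G \<alpha> x y = (\<Sum>e \<in> forward_edges G x y. \<alpha> e)"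

text \<open>Nonemptiness is part of \<open>Digraph_Component.connected\<close>.\<close>

definition subtree :: "'v pair_pre_digraph \<Rightarrow> 'v pair_pre_digraph \<Rightarrow> bool" where
  "subtree F G \<longleftrightarrow>
    subgraph (with_proj F) (with_proj G) \<and> Digraph_Component.connected (with_proj F)"

definition subtree_dist ::
    "'v pair_pre_digraph \<Rightarrow> ('v \<times> 'v \<Rightarrow> real) \<Rightarrow>
     'v pair_pre_digraph \<Rightarrow> 'v pair_pre_digraph \<Rightarrow> real" where
  "subtree_dist G \<alpha> F F' = Min {tree_dist G \<alpha> x y | x y. x \<in> pverts F \<and> y \<in> pverts F'}"

definition oriented_tree_realization ::
    "'s set \<Rightarrow> ('s \<Rightarrow> 's \<Rightarrow> real) \<Rightarrow>
     'v pair_pre_digraph \<Rightarrow> ('v \<times> 'v \<Rightarrow> real) \<Rightarrow> ('s \<Rightarrow> 'v pair_pre_digraph) \<Rightarrow> bool" where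
  "oriented_tree_realization S \<mu> G \<alpha> F \<longleftrightarrow>
    oriented_tree G \<and>
    (\<forall>e \<in> parcs G. 0 < \<alpha> e) \<and>
    (\<forall>s\<in>S. subtree (F s) G) \<and>
    (\<forall>s\<in>S. \<forall>t\<in>S. \<mu> s t = subtree_dist G \<alpha> (F s) (F t))"

end

theory Submission
  imports Defs
begin

text \<open>
  A directed path with positive edge lengths is a finite set of points on the real line, and its
  subtrees are intervals \<open>[a s, b s]\<close>; the distance from the interval of \<open>s\<close> to the one of \<open>t\<close> is
  \<open>max 0 (a t - b s)\<close>. So a realization by a directed path is the same as a representation
  \<open>\<mu> s t = max 0 (a t - b s)\<close> (\<open>directed_path_realization_imp_intervals\<close>,
  \<open>intervals_imp_directed_path_realization\<close>). Since \<open>\<mu>\<close> is nonnegative, the four-point condition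
  only says something when \<open>\<mu> s u\<close> and \<open>\<mu> t v\<close> are positive, and then it reads
  \<open>\<mu> s u + \<mu> t v \<le> \<mu> s v + \<mu> t u\<close>. This form, called \<open>positive_crossing\<close> below, is compared
  with the interval representation and with the dimension.

  Intervals: for distances \<open>max 0 (a t - b s)\<close> the crossing inequality is immediate. Conversely, it
  makes a row of \<open>\<mu>\<close> with the largest sum dominate all other rows entrywise. Use this row as the
  left end points \<open>a\<close>, and as \<open>b s\<close> the largest drop of an entry from this row to row \<open>s\<close>. At the
  zero entries of row \<open>s\<close> this is large enough; at its positive entries the drop has to be the
  largest one, which is again the crossing inequality
  (\<open>intervals_if_positive_crossing\<close>).

  Dimension: at a point \<open>p\<close> of the tight span every positive coordinate lies on a tight pair
  \<open>p (s\<^sup>c) + p (t\<^sup>r) = \<mu> s t\<close>. A face of the tight span having \<open>p\<close> in its relative interior may only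
  move along directions that preserve tight pairs and zeros, which leaves one degree of freedom for each
  connected component, without zero coordinates, of the bipartite graph of tight pairs.
  By the crossing inequality two tight pairs with positive coordinates have tight cross pairs as
  well, so there is at most one such component (\<open>aff_dim_convex_tight_span_le\<close>). If, on the
  other hand, the inequality fails for \<open>s, t, u, v\<close>, then the pairs \<open>(s, u)\<close> and \<open>(t, v)\<close> can be
  kept tight while the coordinates of \<open>s\<close> and \<open>t\<close> vary independently over an open subset
  of the plane. The projection of the tight span to these two coordinates is then not negligible,
  and finitely many faces of dimension at most one cannot cover it
  (\<open>positive_crossing_if_faces_aff_dim_le\<close>).
\<close>

section \<open>The four-point condition and intervals on the line\<close>

text \<open>
  A Monge-type inequality for the matrix \<open>\<mu>\<close>, restricted to its support; it is the four-point
  condition without the maximum.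
\<close>

definition positive_crossing :: "'s set \<Rightarrow> ('s \<Rightarrow> 's \<Rightarrow> real) \<Rightarrow> bool" where
  "positive_crossing S \<mu> \<longleftrightarrow>
    (\<forall>s\<in>S. \<forall>t\<in>S. \<forall>u\<in>S. \<forall>v\<in>S.
      0 < \<mu> s u \<longrightarrow> 0 < \<mu> t v \<longrightarrow> \<mu> s u + \<mu> t v \<le> \<mu> s v + \<mu> t u)"

text \<open>
  If \<open>\<mu> s u\<close> and \<open>\<mu> t v\<close> are positive, each of them is less than their sum, while \<open>\<mu> s v\<close> and
  \<open>\<mu> t u\<close> are at most the first entry of the maximum, which thus alone decides. If one of them is
  zero, the sum is the other one.
\<close>

lemma positive_crossing_iff_four_point:
  assumes "directed_distance_on S \<mu>"
  shows "positive_crossing S \<mu> \<longleftrightarrow>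
    (\<forall>s\<in>S. \<forall>t\<in>S. \<forall>u\<in>S. \<forall>v\<in>S.
      \<mu> s u + \<mu> t v \<le> Max {\<mu> s v + \<mu> t u, \<mu> s u, \<mu> s v, \<mu> t u, \<mu> t v})"
proof -
  have "(0 < \<mu> s u \<longrightarrow> 0 < \<mu> t v \<longrightarrow> \<mu> s u + \<mu> t v \<le> \<mu> s v + \<mu> t u) \<longleftrightarrow>
      \<mu> s u + \<mu> t v \<le> Max {\<mu> s v + \<mu> t u, \<mu> s u, \<mu> s v, \<mu> t u, \<mu> t v}"
    if "s \<in> S" "t \<in> S" "u \<in> S" "v \<in> S" for s t u v
  proof -
    have "0 \<le> \<mu> s u" "0 \<le> \<mu> s v" "0 \<le> \<mu> t u" "0 \<le> \<mu> t v"
      using assms that by (auto simp: directed_distance_on_def)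
    then show ?thesis by (auto simp: Max_ge_iff)
  qed
  then show ?thesis unfolding positive_crossing_def by blast
qed

text \<open>
  If both summands on the left are positive, each is the difference of its end points; exchanging the
  left end points preserves the sum of these differences, and truncating at zero only increases it.
\<close>

lemma positive_crossing_if_intervals:
  fixes a b :: "'s \<Rightarrow> real"
  assumes "\<forall>s\<in>S. \<forall>t\<in>S. \<mu> s t = max 0 (a t - b s)"
  shows "positive_crossing S \<mu>"
  unfolding positive_crossing_def using assms by (auto simp: max_def)

lemma intervals_if_positive_crossing:
  assumes "finite S" and dd: "directed_distance_on S \<mu>" and cross: "positive_crossing S \<mu>"
  shows "\<exists>a b. \<forall>s\<in>S. \<forall>t\<in>S. \<mu> s t = max 0 (a t - b s :: real)"
proof (cases "S = {}")
  case False
  have nonneg: "0 \<le> \<mu> s t" if "s \<in> S" "t \<in> S" for s t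
    using dd that by (simp add: directed_distance_on_def)
  have crossD: "\<mu> s u + \<mu> t v \<le> \<mu> s v + \<mu> t u"
    if "s \<in> S" "t \<in> S" "u \<in> S" "v \<in> S" "0 < \<mu> s u" "0 < \<mu> t v" for s t u v
    using cross that unfolding positive_crossing_def by blast
  define rowsum where "rowsum s = (\<Sum>u\<in>S. \<mu> s u)" for s
  obtain r where r: "r \<in> S" and max: "\<And>s. s \<in> S \<Longrightarrow> rowsum s \<le> rowsum r"
  proof -
    have "Max (rowsum ` S) \<in> rowsum ` S" using \<open>finite S\<close> False by (intro Max_in) auto
    then obtain r where "r \<in> S" "rowsum r = Max (rowsum ` S)" by force
    then show thesis using that \<open>finite S\<close> by simp
  qed
  have dominates: "\<mu> s u \<le> \<mu> r u" if su: "s \<in> S" "u \<in> S" for s u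
  proof (rule ccontr)
    assume less: "\<not> \<mu> s u \<le> \<mu> r u"
    \<comment> \<open>Row \<open>r\<close> makes up for the smaller entry at \<open>u\<close> by a larger one at some \<open>v\<close>.\<close>
    have "\<exists>v\<in>S. \<mu> s v < \<mu> r v"
    proof (rule ccontr)
      assume "\<not> ?thesis"
      then have "rowsum r < rowsum s"
        unfolding rowsum_def using \<open>finite S\<close> su less
        by (intro sum_strict_mono_ex1) (auto simp: not_less not_le intro!: bexI[of _ u])
      then show False using max[OF su(1)] by simp
    qed
    then obtain v where v: "v \<in> S" "\<mu> s v < \<mu> r v" by blast
    have "0 < \<mu> s u" "0 < \<mu> r v"
      using less v nonneg[OF r su(2)] nonneg[OF su(1) v(1)] by auto
    then show False using crossD[OF su(1) r su(2) v(1)] less v by simp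
  qed
  define b where "b s = Max ((\<lambda>u. \<mu> r u - \<mu> s u) ` S)" for s
  have b_ge: "\<mu> r u - \<mu> s u \<le> b s" if "u \<in> S" for s u
    unfolding b_def using \<open>finite S\<close> that by (intro Max_ge) auto
  have "\<mu> s t = max 0 (\<mu> r t - b s)" if st: "s \<in> S" "t \<in> S" for s t
  proof (cases "0 < \<mu> s t")
    case True
    have "\<mu> r v - \<mu> s v \<le> \<mu> r t - \<mu> s t" if v: "v \<in> S" for v
    proof (cases "0 < \<mu> r v")
      case True
      then show ?thesis using crossD[OF st(1) r st(2) v] \<open>0 < \<mu> s t\<close> by simp
    next
      case False
      then show ?thesis using nonneg[OF st(1) v] dominates[OF st] by simp
    qed
    then have "b s = \<mu> r t - \<mu> s t"
      unfolding b_def using \<open>finite S\<close> st by (intro Max_eqI) auto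
    then show ?thesis using True by simp
  next
    case False
    then show ?thesis using nonneg[OF st] b_ge[OF st(2), of s] by simp
  qed
  then show ?thesis by blast
qed simp

section \<open>Dimension of the directed tight span\<close>

lemma dist_polyhedron_nonneg: "p \<in> dist_polyhedron S \<mu> \<Longrightarrow> 0 \<le> p $ i"
  unfolding dist_polyhedron_def by (cases "i \<in> S <+> S") auto

lemma dist_polyhedron_dist:
  "p \<in> dist_polyhedron S \<mu> \<Longrightarrow> s \<in> S \<Longrightarrow> t \<in> S \<Longrightarrow> \<mu> s t \<le> p $ Inl s + p $ Inr t"
  unfolding dist_polyhedron_def by auto

lemma polyhedron_dist_polyhedron: "polyhedron (dist_polyhedron S \<mu>)"
proof -
  have "dist_polyhedron S \<mu> =
      (\<Inter>i\<in>S <+> S. {p. axis i 1 \<bullet> p \<ge> 0}) \<inter>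
      (\<Inter>i\<in>- (S <+> S). {p. axis i 1 \<bullet> p = 0}) \<inter>
      (\<Inter>(s, t)\<in>S \<times> S. {p. (axis (Inl s) 1 + axis (Inr t) 1) \<bullet> p \<ge> \<mu> s t})"
    unfolding dist_polyhedron_def by (auto simp: inner_axis' inner_add_left)
  moreover have "polyhedron \<dots>"
    by (intro polyhedron_Int polyhedron_Inter finite_imageI)
      (auto intro: polyhedron_halfspace_ge polyhedron_hyperplane finite_subset[OF subset_UNIV])
  ultimately show ?thesis by simp
qed

text \<open>
  A point of the polyhedron below \<open>p\<close> with the smallest coordinate sum is a minimal element; it
  exists because the part of the polyhedron below \<open>p\<close> is compact.
\<close>

lemma tight_span_below:
  assumes "p \<in> dist_polyhedron S \<mu>"
  obtains q where "q \<in> directed_tight_span S \<mu>" "q \<le> p"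
proof -
  let ?P = "dist_polyhedron S \<mu>"
  let ?C = "?P \<inter> cbox 0 p"
  have mem: "q \<in> ?C \<longleftrightarrow> q \<in> ?P \<and> q \<le> p" for q
    by (auto simp: cbox_interval less_eq_vec_def dist_polyhedron_nonneg)
  have "compact ?C"
    by (intro closed_Int_compact polyhedron_imp_closed polyhedron_dist_polyhedron compact_cbox)
  moreover have "?C \<noteq> {}" using assms mem by blast
  moreover have "continuous_on ?C (\<lambda>q. \<Sum>i\<in>UNIV. q $ i)" by (intro continuous_intros)
  ultimately obtain q where q: "q \<in> ?C"
    and min: "\<And>r. r \<in> ?C \<Longrightarrow> (\<Sum>i\<in>UNIV. q $ i) \<le> (\<Sum>i\<in>UNIV. r $ i)"
    using continuous_attains_inf[of ?C] by blast
  have "\<not> (r \<in> ?P \<and> r \<noteq> q \<and> r \<le> q)" for r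
  proof
    assume r: "r \<in> ?P \<and> r \<noteq> q \<and> r \<le> q"
    then obtain i where "r $ i \<noteq> q $ i" by (auto simp: vec_eq_iff)
    then have "(\<Sum>i\<in>UNIV. r $ i) < (\<Sum>i\<in>UNIV. q $ i)"
      using r by (intro sum_strict_mono_ex1) (auto simp: less_eq_vec_def intro!: exI[of _ i] less_le[THEN iffD2])
    moreover have "r \<in> ?C" using r q mem by (meson order_trans)
    ultimately show False using min by fastforce
  qed
  then have "q \<in> directed_tight_span S \<mu>" using q by (auto simp: directed_tight_span_def)
  then show thesis using that q mem by blast
qed

lemma tight_span_lowered_not_in_polyhedron:
  assumes p: "p \<in> directed_tight_span S \<mu>" and "0 < \<epsilon>"
  shows "(\<chi> j. if j = i then p $ j - \<epsilon> else p $ j) \<notin> dist_polyhedron S \<mu>" (is "?q \<notin> _")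
proof -
  have "?q \<le> p" "?q \<noteq> p"
    using \<open>0 < \<epsilon>\<close> by (auto simp: less_eq_vec_def vec_eq_iff)
  then show ?thesis using p by (auto simp: directed_tight_span_def)
qed

text \<open>
  In a minimal point every positive coordinate is held in place by a tight pair: otherwise it could be
  lowered by the least slack \<open>\<epsilon>\<close> of the constraints that involve it.
\<close>

lemma tight_span_tight_left:
  assumes p: "p \<in> directed_tight_span S \<mu>" and s: "s \<in> S" and pos: "0 < p $ Inl s"
  shows "\<exists>t\<in>S. p $ Inl s + p $ Inr t = \<mu> s t"
proof (rule ccontr)
  assume no: "\<not> ?thesis"
  have P: "p \<in> dist_polyhedron S \<mu>" using p by (simp add: directed_tight_span_def)
  define \<epsilon> where "\<epsilon> = Min (insert (p $ Inl s) ((\<lambda>t. p $ Inl s + p $ Inr t - \<mu> s t) ` S))"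
  have "\<mu> s t < p $ Inl s + p $ Inr t" if "t \<in> S" for t
    using no dist_polyhedron_dist[OF P s that] that by (auto simp: less_le)
  then have \<epsilon>: "0 < \<epsilon>" using pos by (simp add: \<epsilon>_def)
  have \<epsilon>_le_p: "\<epsilon> \<le> p $ Inl s" by (simp add: \<epsilon>_def)
  have slack: "\<epsilon> \<le> p $ Inl s + p $ Inr t - \<mu> s t" if "t \<in> S" for t
    unfolding \<epsilon>_def using that by (intro Min_le) auto
  have "(\<chi> j. if j = Inl s then p $ j - \<epsilon> else p $ j) \<in> dist_polyhedron S \<mu>" (is "?q \<in> _")
  proof -
    have "\<mu> x y \<le> ?q $ Inl x + ?q $ Inr y" if "x \<in> S" "y \<in> S" for x y
      using dist_polyhedron_dist[OF P that] slack[OF that(2)] by auto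
    moreover have "0 \<le> ?q $ i" for i
      using dist_polyhedron_nonneg[OF P, of i] \<epsilon>_le_p by auto
    moreover have "?q $ i = 0" if "i \<notin> S <+> S" for i
      using P s that by (auto simp: dist_polyhedron_def)
    ultimately show ?thesis by (simp only: dist_polyhedron_def mem_Collect_eq) blast
  qed
  then show False using tight_span_lowered_not_in_polyhedron[OF p \<epsilon>] by blast
qed

lemma tight_span_tight_right:
  assumes p: "p \<in> directed_tight_span S \<mu>" and t: "t \<in> S" and pos: "0 < p $ Inr t"
  shows "\<exists>s\<in>S. p $ Inl s + p $ Inr t = \<mu> s t"
proof (rule ccontr)
  assume no: "\<not> ?thesis"
  have P: "p \<in> dist_polyhedron S \<mu>" using p by (simp add: directed_tight_span_def)
  define \<epsilon> where "\<epsilon> = Min (insert (p $ Inr t) ((\<lambda>s. p $ Inl s + p $ Inr t - \<mu> s t) ` S))"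
  have "\<mu> s t < p $ Inl s + p $ Inr t" if "s \<in> S" for s
    using no dist_polyhedron_dist[OF P that t] that by (auto simp: less_le)
  then have \<epsilon>: "0 < \<epsilon>" using pos by (simp add: \<epsilon>_def)
  have \<epsilon>_le_p: "\<epsilon> \<le> p $ Inr t" by (simp add: \<epsilon>_def)
  have slack: "\<epsilon> \<le> p $ Inl s + p $ Inr t - \<mu> s t" if "s \<in> S" for s
    unfolding \<epsilon>_def using that by (intro Min_le) auto
  have "(\<chi> j. if j = Inr t then p $ j - \<epsilon> else p $ j) \<in> dist_polyhedron S \<mu>" (is "?q \<in> _")
  proof -
    have "\<mu> x y \<le> ?q $ Inl x + ?q $ Inr y" if "x \<in> S" "y \<in> S" for x y
      using dist_polyhedron_dist[OF P that] slack[OF that(1)] by auto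
    moreover have "0 \<le> ?q $ i" for i
      using dist_polyhedron_nonneg[OF P, of i] \<epsilon>_le_p by auto
    moreover have "?q $ i = 0" if "i \<notin> S <+> S" for i
      using P t that by (auto simp: dist_polyhedron_def)
    ultimately show ?thesis by (simp only: dist_polyhedron_def mem_Collect_eq) blast
  qed
  then show False using tight_span_lowered_not_in_polyhedron[OF p \<epsilon>] by blast
qed

text \<open>
  A segment of \<open>F\<close> from \<open>q\<close> can be prolonged beyond the relative interior point \<open>p\<close>; a linear
  function that is minimal on \<open>F\<close> at \<open>p\<close> is therefore constant along it.
\<close>

lemma tight_on_convex:
  fixes F :: "'a::euclidean_space set"
  assumes F: "convex F" and p: "p \<in> rel_interior F" and q: "q \<in> F"
    and g: "linear g" and lower: "\<And>r. r \<in> F \<Longrightarrow> c \<le> g r" and tight: "g p = (c::real)"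
  shows "g q = c"
proof -
  have "F \<noteq> {}" using q by blast
  then obtain e where e: "e > 1" "(1 - e) *\<^sub>R q + e *\<^sub>R p \<in> F"
    using convex_rel_interior_iff[OF F] p q by blast
  then have "c \<le> (1 - e) * g q + e * g p"
    using lower[OF e(2)] g by (simp add: linear_add linear_cmul)
  then have "(e - 1) * (g q - c) \<le> 0" using tight by (simp add: algebra_simps)
  then have "g q \<le> c" using e(1) by (simp add: mult_le_0_iff)
  then show ?thesis using lower[OF q] by simp
qed

text \<open>
  Take \<open>p\<close> in the relative interior of \<open>F\<close>. Moving from \<open>p\<close> to another point of \<open>F\<close> keeps zero
  coordinates zero, and along a tight pair the two coordinates change by opposite amounts. A coordinate
  tight with a zero coordinate hence does not change at all. The others lie on tight pairs with two positive
  coordinates (\<open>core\<close>); by the crossing inequality any two such pairs are tight crosswise too (\<open>join\<close>),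
  so they all share one amount of change \<open>c\<close>, with opposite signs on the two copies of \<open>S\<close>.
  All of \<open>F\<close> is thus on one line with direction \<open>d\<close>.
\<close>

lemma aff_dim_convex_tight_span_le:
  assumes cross: "positive_crossing S \<mu>"
    and F: "convex F" "F \<subseteq> directed_tight_span S \<mu>"
  shows "aff_dim F \<le> 1"
proof (cases "F = {}")
  case False
  then obtain p where p: "p \<in> rel_interior F"
    using rel_interior_eq_empty[OF F(1)] by blast
  have pF: "p \<in> F" using p rel_interior_subset by blast
  have FP: "F \<subseteq> dist_polyhedron S \<mu>" using F(2) by (auto simp: directed_tight_span_def)
  have pT: "p \<in> directed_tight_span S \<mu>" and pP: "p \<in> dist_polyhedron S \<mu>"
    using pF F(2) FP by auto
  define tight where "tight x y \<longleftrightarrow> x \<in> S \<and> y \<in> S \<and> p $ Inl x + p $ Inr y = \<mu> x y" for x y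
  define core where
    "core x y \<longleftrightarrow> tight x y \<and> 0 < p $ Inl x \<and> 0 < p $ Inr y" for x y
  define d where
    "d = (\<chi> i. case i of Inl x \<Rightarrow> (if \<exists>y. core x y then 1 else 0)
                     | Inr y \<Rightarrow> (if \<exists>x. core x y then - 1 else 0 :: real))"
  have join: "tight x y'" if "core x y" "core x' y'" for x y x' y'
  proof -
    have S: "x \<in> S" "y \<in> S" "x' \<in> S" "y' \<in> S"
      and eq: "p $ Inl x + p $ Inr y = \<mu> x y" "p $ Inl x' + p $ Inr y' = \<mu> x' y'"
      and pos: "0 < \<mu> x y" "0 < \<mu> x' y'"
      using that by (auto simp: core_def tight_def)
    have "\<mu> x y + \<mu> x' y' \<le> \<mu> x y' + \<mu> x' y"
      using cross S pos unfolding positive_crossing_def by blast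
    then show ?thesis
      using eq dist_polyhedron_dist[OF pP S(1,4)] dist_polyhedron_dist[OF pP S(3,2)] S
      by (simp add: tight_def)
  qed
  have line: "\<exists>c. q = p + c *\<^sub>R d" if q: "q \<in> F" for q
  proof -
    have zero: "q $ i = 0" if "p $ i = 0" for i
      using tight_on_convex[OF F(1) p q, of "\<lambda>r. r $ i" 0] dist_polyhedron_nonneg[OF subsetD[OF FP]] that
      by (auto simp: linear_iff)
    have edge: "q $ Inl x + q $ Inr y = p $ Inl x + p $ Inr y" if "tight x y" for x y
      using tight_on_convex[OF F(1) p q, of "\<lambda>r. r $ Inl x + r $ Inr y" "\<mu> x y"] dist_polyhedron_dist[OF subsetD[OF FP]] that
      by (auto simp: tight_def linear_iff algebra_simps)
    \<comment> \<open>The change at the left end of an arbitrary core pair; zero if there is none, and then \<open>d = 0\<close>.\<close>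
    define c where
      "c = (if \<exists>x y. core x y then let x = SOME x. \<exists>y. core x y in q $ Inl x - p $ Inl x else 0)"
    have c: "q $ Inl x - p $ Inl x = c" "q $ Inr y - p $ Inr y = - c" if xy: "core x y" for x y
    proof -
      define x\<^sub>0 where "x\<^sub>0 = (SOME x. \<exists>y. core x y)"
      have "\<exists>y. core x\<^sub>0 y" unfolding x\<^sub>0_def by (rule someI) (use xy in blast)
      then obtain y\<^sub>0 where xy\<^sub>0: "core x\<^sub>0 y\<^sub>0" by blast
      have "c = q $ Inl x\<^sub>0 - p $ Inl x\<^sub>0"
        using xy unfolding c_def x\<^sub>0_def Let_def by auto
      then show "q $ Inl x - p $ Inl x = c" "q $ Inr y - p $ Inr y = - c"
        using edge[of x y] edge[of x\<^sub>0 y] xy edge[OF join[OF xy\<^sub>0 xy]] unfolding core_def by auto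
    qed
    have "q $ i = p $ i + c * d $ i" for i
    proof (cases "i \<in> S <+> S \<and> 0 < p $ i")
      case False
      have "p $ i = 0"
        using False pP dist_polyhedron_nonneg[OF pP, of i] by (auto simp: dist_polyhedron_def)
      moreover have "d $ i = 0"
        using calculation by (auto simp: d_def core_def split: sum.splits)
      ultimately show ?thesis using zero by simp
    next
      case True
      show ?thesis
      proof (cases i)
        case (Inl x)
        then obtain y where y: "y \<in> S" "p $ Inl x + p $ Inr y = \<mu> x y"
          using True tight_span_tight_left[OF pT, of x] by auto
        then have t: "tight x y" using True Inl by (auto simp: tight_def)
        show ?thesis
        proof (cases "\<exists>y. core x y")
          case True
          then show ?thesis using c(1) Inl by (auto simp: d_def algebra_simps)
        next
          case False
          then have "p $ Inr y = 0"
            using t True Inl dist_polyhedron_nonneg[OF pP, of "Inr y"] by (auto simp: core_def less_le)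
          then show ?thesis using edge[OF t] zero[of "Inr y"] Inl False by (auto simp: d_def)
        qed
      next
        case (Inr y)
        then obtain x where x: "x \<in> S" "p $ Inl x + p $ Inr y = \<mu> x y"
          using True tight_span_tight_right[OF pT, of y] by auto
        then have t: "tight x y" using True Inr by (auto simp: tight_def)
        show ?thesis
        proof (cases "\<exists>x. core x y")
          case True
          then show ?thesis using c(2) Inr by (auto simp: d_def algebra_simps)
        next
          case False
          then have "p $ Inl x = 0"
            using t True Inr dist_polyhedron_nonneg[OF pP, of "Inl x"] by (auto simp: core_def less_le)
          then show ?thesis using edge[OF t] zero[of "Inl x"] Inr False by (auto simp: d_def)
        qed
      qed
    qed
    then show ?thesis by (intro exI[of _ c]) (simp add: vec_eq_iff)
  qed
  have "F \<subseteq> affine hull {p, p + d}"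
  proof
    fix q assume "q \<in> F"
    then obtain c where "q = p + c *\<^sub>R d" using line by blast
    then have "q = (1 - c) *\<^sub>R p + c *\<^sub>R (p + d)" by (simp add: algebra_simps)
    then show "q \<in> affine hull {p, p + d}" 
      unfolding affine_hull_2 by (intro CollectI exI[of _ "1 - c"] exI[of _ c]) simp
  qed
  then have "aff_dim F \<le> aff_dim {p, p + d}"
    using aff_dim_subset aff_dim_affine_hull by metis
  also have "\<dots> \<le> 1" by (simp add: aff_dim_2)
  finally show ?thesis .
qed simp

text \<open>
  The smallest face containing \<open>p\<close> works: were \<open>p\<close> in its relative frontier, it would lie in a
  proper face of that face.
\<close>

lemma polyhedron_point_in_rel_interior_of_face:
  fixes P :: "'a::euclidean_space set"
  assumes P: "polyhedron P" and p: "p \<in> P"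
  obtains F where "F face_of P" "p \<in> rel_interior F"
proof -
  define F where "F = \<Inter>{F. F face_of P \<and> p \<in> F}"
  have ne: "P \<in> {F. F face_of P \<and> p \<in> F}"
    using p by (simp add: face_of_refl polyhedron_imp_convex[OF P])
  have F: "F face_of P" unfolding F_def using ne by (intro face_of_Inter) auto
  have pF: "p \<in> F" unfolding F_def by blast
  have polyF: "polyhedron F" using F P face_of_polyhedron_polyhedron by blast
  have "p \<in> rel_interior F"
  proof (rule ccontr)
    assume "p \<notin> rel_interior F"
    then have "p \<in> rel_frontier F"
      using pF polyhedron_imp_closed[OF polyF] by (simp add: rel_frontier_def)
    then obtain G where G: "G face_of F" "G \<noteq> F" "p \<in> G"
      using rel_frontier_of_polyhedron_alt[OF polyF] by auto
    then have "G face_of P" using F face_of_trans by blast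
    then have "F \<subseteq> G" unfolding F_def using G(3) by blast
    then show False using G face_of_imp_subset by blast
  qed
  then show thesis using that F by blast
qed

text \<open>
  This makes the tight span a union of faces. If some \<open>q\<close> in \<open>F\<close> could be lowered to \<open>r\<close>, write \<open>p\<close> as
  a proper convex combination of \<open>q\<close> and a further point \<open>z\<close> of \<open>F\<close>; replacing \<open>q\<close> by \<open>r\<close> in it
  gives a point below \<open>p\<close>, against the minimality of \<open>p\<close>.
\<close>

lemma face_subset_tight_span:
  assumes F: "F face_of dist_polyhedron S \<mu>"
    and p: "p \<in> rel_interior F" "p \<in> directed_tight_span S \<mu>"
  shows "F \<subseteq> directed_tight_span S \<mu>"
proof
  fix q assume q: "q \<in> F"
  let ?P = "dist_polyhedron S \<mu>"
  have FP: "F \<subseteq> ?P" using F face_of_imp_subset by blast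
  have "\<not> (r \<in> ?P \<and> r \<noteq> q \<and> r \<le> q)" for r
  proof
    assume r: "r \<in> ?P \<and> r \<noteq> q \<and> r \<le> q"
    have "convex F" "F \<noteq> {}" using F face_of_imp_convex q by blast+
    then obtain e where e: "e > 1" "(1 - e) *\<^sub>R q + e *\<^sub>R p \<in> F"
      using convex_rel_interior_iff p q by blast
    define z where "z = (1 - e) *\<^sub>R q + e *\<^sub>R p"
    define r' where "r' = (1 - 1 / e) *\<^sub>R r + (1 / e) *\<^sub>R z"
    have "z = q + e *\<^sub>R (p - q)" by (simp add: z_def algebra_simps)
    then have p_eq: "p = (1 - 1 / e) *\<^sub>R q + (1 / e) *\<^sub>R z"
      using e(1) by (simp add: scaleR_diff_left scaleR_add_right)
    have diff: "p - r' = (1 - 1 / e) *\<^sub>R (q - r)"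
      by (subst p_eq) (simp add: r'_def algebra_simps)
    have coeff: "0 < 1 - 1 / e" using e(1) by simp
    have "convex ?P" using polyhedron_imp_convex polyhedron_dist_polyhedron by blast
    then have "r' \<in> ?P"
      unfolding r'_def using r e FP coeff by (intro convexD) (auto simp: z_def)
    moreover have "r' \<le> p"
    proof -
      have "0 \<le> (p - r') $ i" for i
        unfolding diff using coeff r by (simp add: less_eq_vec_def)
      then show ?thesis by (simp add: less_eq_vec_def)
    qed
    moreover have "r' \<noteq> p" using diff coeff r by auto
    ultimately show False using p(2) by (auto simp: directed_tight_span_def)
  qed
  then show "q \<in> directed_tight_span S \<mu>" using q FP by (auto simp: directed_tight_span_def)
qed

text \<open>
  A violation of the crossing inequality at \<open>s, t, u, v\<close> leaves an open set \<open>U\<close> of choices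
  \<open>(a, b)\<close> for the coordinates of \<open>s\<^sup>c\<close> and \<open>t\<^sup>c\<close>, if those of \<open>u\<^sup>r\<close> and \<open>v\<^sup>r\<close> are set to
  \<open>\<mu> s u - a\<close> and \<open>\<mu> t v - b\<close>. Each choice extends to the polyhedron by large values elsewhere.
  Passing to a minimal point below keeps the four coordinates, since \<open>(s, u)\<close> and
  \<open>(t, v)\<close> are tight. So \<open>U\<close> lies in the projection of the tight span, which is
  a finite union of negligible sets if all its faces have dimension at most one.
\<close>

lemma positive_crossing_if_faces_aff_dim_le:
  fixes S :: "'s::finite set"
  assumes dd: "directed_distance_on S \<mu>"
    and faces: "\<And>F. F face_of dist_polyhedron S \<mu> \<Longrightarrow> F \<subseteq> directed_tight_span S \<mu> \<Longrightarrow> aff_dim F \<le> 1"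
  shows "positive_crossing S \<mu>"
proof (rule ccontr)
  let ?P = "dist_polyhedron S \<mu>" and ?T = "directed_tight_span S \<mu>"
  assume "\<not> positive_crossing S \<mu>"
  then obtain s t u v where S: "s \<in> S" "t \<in> S" "u \<in> S" "v \<in> S"
    and pos: "0 < \<mu> s u" "0 < \<mu> t v" and viol: "\<mu> s v + \<mu> t u < \<mu> s u + \<mu> t v"
    unfolding positive_crossing_def by force
  have nn: "0 \<le> \<mu> x y" if "x \<in> S" "y \<in> S" for x y
    using dd that by (simp add: directed_distance_on_def)
  have neq: "s \<noteq> t" "u \<noteq> v" using viol by auto
  define f where "f p = (p $ Inl s, p $ Inl t)" for p :: "real ^ ('s + 's)"
  define U where "U = {(a, b). 0 < a \<and> a < \<mu> s u \<and> 0 < b \<and> b < \<mu> t v \<and>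
    \<mu> s v - \<mu> t v < a - b \<and> a - b < \<mu> s u - \<mu> t u}"
  have "open U"
    unfolding U_def case_prod_beta'
    by (intro open_Collect_conj open_Collect_less continuous_intros)
  moreover have "U \<noteq> {}"
  proof -
    obtain c where c: "\<mu> s v - \<mu> t v < c" "c < \<mu> s u - \<mu> t u"
      using dense[of "\<mu> s v - \<mu> t v" "\<mu> s u - \<mu> t u"] viol by auto
    have "max 0 c < min (\<mu> s u) (\<mu> t v + c)"
      using c pos nn[OF S(1,4)] nn[OF S(2,3)] by auto
    then obtain a where "max 0 c < a" "a < min (\<mu> s u) (\<mu> t v + c)" using dense by blast
    then have "(a, a - c) \<in> U" using c by (auto simp: U_def)
    then show ?thesis by blast
  qed
  ultimately have "\<not> negligible U" by (rule open_not_negligible)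
  moreover have "negligible U"
  proof (rule negligible_subset)
    let ?\<F> = "{F. F face_of ?P \<and> F \<subseteq> ?T}"
    have "linear f" by (auto simp: f_def linear_iff)
    have "negligible (f ` F)" if "F \<in> ?\<F>" for F
    proof -
      have "convex (f ` F)"
        using that face_of_imp_convex \<open>linear f\<close> convex_linear_image by blast
      moreover have "aff_dim (f ` F) \<le> 1"
        using faces that aff_dim_linear_image_le[OF \<open>linear f\<close>, of F] by force
      ultimately show ?thesis
        by (subst negligible_convex_interior) (auto intro!: low_dim_interior)
    qed
    moreover have "finite ?\<F>"
      by (rule rev_finite_subset[OF finite_polyhedron_faces[OF polyhedron_dist_polyhedron]]) auto
    ultimately show "negligible (\<Union>F\<in>?\<F>. f ` F)" by (intro negligible_Union) auto
    show "U \<subseteq> (\<Union>F\<in>?\<F>. f ` F)"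
    proof
      fix ab assume "ab \<in> U"
      then obtain a b where ab: "ab = (a, b)" "0 < a" "a < \<mu> s u" "0 < b" "b < \<mu> t v"
        "\<mu> s v - \<mu> t v < a - b" "a - b < \<mu> s u - \<mu> t u"
        unfolding U_def by auto
      \<comment> \<open>A value that satisfies every constraint on its own.\<close>
      define B where "B = (\<Sum>x\<in>S. \<Sum>y\<in>S. \<mu> x y)"
      have B: "\<mu> x y \<le> B" if "x \<in> S" "y \<in> S" for x y
      proof -
        have "\<mu> x y \<le> (\<Sum>y\<in>S. \<mu> x y)" using that nn by (intro member_le_sum) auto
        also have "\<dots> \<le> B" unfolding B_def using that nn
          by (intro member_le_sum[where f = "\<lambda>x. \<Sum>y\<in>S. \<mu> x y"]) (auto intro: sum_nonneg)
        finally show ?thesis .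
      qed
      have B0: "0 \<le> B" using B[OF S(1,3)] pos by simp
      define p where "p = (\<chi> i. case i of
          Inl x \<Rightarrow> if x \<notin> S then 0 else if x = s then a else if x = t then b else B
        | Inr y \<Rightarrow> if y \<notin> S then 0 else if y = u then \<mu> s u - a else if y = v then \<mu> t v - b else B)"
      have "p \<in> ?P"
      proof -
        have "\<mu> x y \<le> p $ Inl x + p $ Inr y" if "x \<in> S" "y \<in> S" for x y
          using that ab B[OF that] B0 neq by (auto simp: p_def)
        moreover have "0 \<le> p $ i" for i
          using ab B0 by (auto simp: p_def split: sum.splits)
        moreover have "p $ i = 0" if "i \<notin> S <+> S" for i
          using that by (auto simp: p_def split: sum.splits)
        ultimately show ?thesis by (auto simp: dist_polyhedron_def)
      qed
      then obtain q where q: "q \<in> ?T" "q \<le> p" by (rule tight_span_below)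
      then have qP: "q \<in> ?P" by (simp add: directed_tight_span_def)
      have le: "q $ i \<le> p $ i" for i using q(2) by (simp add: less_eq_vec_def)
      have "q $ Inl s = a" "q $ Inl t = b"
        using le[of "Inl s"] le[of "Inl t"] le[of "Inr u"] le[of "Inr v"]
          dist_polyhedron_dist[OF qP S(1,3)] dist_polyhedron_dist[OF qP S(2,4)] S neq
        by (auto simp: p_def)
      then have "ab = f q" using ab(1) by (simp add: f_def)
      moreover obtain F where F: "F face_of ?P" "q \<in> rel_interior F"
        using polyhedron_point_in_rel_interior_of_face[OF polyhedron_dist_polyhedron qP] by blast
      moreover have "q \<in> F" using F(2) rel_interior_subset by blast
      ultimately show "ab \<in> (\<Union>F\<in>?\<F>. f ` F)"
        using face_subset_tight_span[OF F q(1)] by blast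
    qed
  qed
  ultimately show False by blast
qed

lemma dim_directed_tight_span_le_iff:
  "dim_directed_tight_span S \<mu> \<le> d \<longleftrightarrow>
    (\<forall>F. F face_of dist_polyhedron S \<mu> \<longrightarrow> F \<subseteq> directed_tight_span S \<mu> \<longrightarrow> aff_dim F \<le> d)"
proof -
  let ?A = "{aff_dim F | F. F face_of dist_polyhedron S \<mu> \<and> F \<subseteq> directed_tight_span S \<mu>}"
  have "?A = aff_dim ` {F. F face_of dist_polyhedron S \<mu> \<and> F \<subseteq> directed_tight_span S \<mu>}" by auto
  also have "finite \<dots>"
    by (intro finite_imageI rev_finite_subset[OF finite_polyhedron_faces[OF polyhedron_dist_polyhedron]])
      auto
  finally have "finite ?A" .
  moreover have "?A \<noteq> {}" using empty_face_of by blast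
  ultimately show ?thesis unfolding dim_directed_tight_span_def by (subst Max_le_iff) auto
qed

lemma dim_tight_span_le_one_iff:
  assumes "directed_distance_on S \<mu>"
  shows "dim_directed_tight_span S \<mu> \<le> 1 \<longleftrightarrow> positive_crossing S \<mu>"
  using positive_crossing_if_faces_aff_dim_le[OF assms] aff_dim_convex_tight_span_le face_of_imp_convex
  unfolding dim_directed_tight_span_le_iff by blast

section \<open>Distances in directed paths\<close>

lemma parcs_underlying: "parcs (mk_symmetric (with_proj G)) = parcs G \<union> (parcs G)\<inverse>"
  by (auto simp: parcs_mk_symmetric)

lemma apath_underlying_iff:
  "pre_digraph.apath (with_proj (mk_symmetric (with_proj G))) x p y \<longleftrightarrow>
    x \<in> pverts G \<and> set p \<subseteq> parcs G \<union> (parcs G)\<inverse> \<and> pcas x p y \<and> distinct (pawalk_verts x p)"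
  by (simp add: pre_digraph.apath_def pre_digraph.awalk_def cas_with_proj_eq
      awalk_verts_with_proj_eq parcs_underlying)

lemma cycle_with_proj_iff:
  "pre_digraph.cycle (with_proj G) p \<longleftrightarrow>
    (\<exists>u \<in> pverts G. set p \<subseteq> parcs G \<and> pcas u p u \<and> distinct (tl (pawalk_verts u p)) \<and> p \<noteq> [])"
  by (auto simp: pre_digraph.cycle_def pre_digraph.awalk_def cas_with_proj_eq
      awalk_verts_with_proj_eq)

text \<open>
  Where a walk changes direction, it uses two arcs that both leave or both enter the
  same vertex; if all degrees are at most one, these arcs agree, and the walk returns to the vertex from
  which it came.
\<close>

lemma path_in_deg_one_relation_monotone:
  assumes "single_valued E" "single_valued (E\<inverse>)"
    and "pcas x p y" "set p \<subseteq> E \<union> E\<inverse>" "distinct (pawalk_verts x p)"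
  shows "set p \<subseteq> E \<or> set p \<subseteq> E\<inverse>"
  using assms(3-)
proof (induction p arbitrary: x)
  case (Cons e p)
  then have IH: "set p \<subseteq> E \<or> set p \<subseteq> E\<inverse>" by auto
  show ?case
  proof (cases p)
    case Nil
    then show ?thesis using Cons.prems by auto
  next
    case (Cons e' p')
    obtain w where e: "e = (x, w)" using Cons.prems(1) by (cases e) auto
    obtain x' where e': "e' = (w, x')" using Cons.prems(1) Cons e by (cases e') auto
    have "x' \<in> set (pawalk_verts x' p')" by (cases p') (use Cons.prems(1) Cons e' in auto)
    then have "x \<noteq> x'" using Cons.prems(3) Cons e e' by auto
    then have "e \<in> E \<longleftrightarrow> e' \<notin> E\<inverse>" "e \<in> E\<inverse> \<longleftrightarrow> e' \<notin> E"
      using assms(1,2) Cons.prems(2) Cons e e' unfolding single_valued_def by auto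
    then show ?thesis using IH Cons.prems(2) Cons by auto
  qed
qed simp

lemma walk_telescopes:
  fixes h :: "'v \<Rightarrow> real"
  assumes "\<forall>(a, b)\<in>E. h b = h a + \<alpha> (a, b)" "pcas x p y" "set p \<subseteq> E"
  shows "sum_list (map \<alpha> p) = h y - h x"
  using assms(2,3)
proof (induction p arbitrary: x)
  case (Cons e p)
  obtain w where e: "e = (x, w)" using Cons.prems(1) by (cases e) auto
  then have "sum_list (map \<alpha> p) = h y - h w" using Cons by auto
  then show ?case using assms(1) Cons.prems e by auto
qed simp

lemma walk_increases:
  fixes h :: "'v \<Rightarrow> real"
  assumes "\<forall>(a, b)\<in>E. h a < h b" "pcas x p y" "set p \<subseteq> E" "p \<noteq> []"
  shows "h x < h y"
  using assms(2-)
proof (induction p arbitrary: x)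
  case (Cons e p)
  obtain w where e: "e = (x, w)" using Cons.prems(1) by (cases e) auto
  then have "h x < h w" using Cons.prems assms(1) by auto
  then show ?case using Cons e by (cases "p = []") (auto intro: less_trans)
qed simp

text \<open>
  With at most one arc leaving each vertex, two walks from \<open>x\<close> to \<open>y\<close> agree until one of them stops
  at \<open>y\<close>. The function \<open>h\<close> excludes that the other one goes on and comes back to \<open>y\<close>.
\<close>

lemma walk_unique:
  fixes h :: "'v \<Rightarrow> real"
  assumes "single_valued E" and h: "\<forall>(a, b)\<in>E. h a < h b"
    and "pcas x p y" "set p \<subseteq> E" "pcas x q y" "set q \<subseteq> E"
  shows "p = q"
  using assms(3-)
proof (induction p arbitrary: x q)
  case Nil
  then show ?case using walk_increases[OF h Nil.prems(3,4)] by auto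
next
  case (Cons e p)
  obtain w where e: "e = (x, w)" using Cons.prems(1) by (cases e) auto
  have "q \<noteq> []" using walk_increases[OF h Cons.prems(1,2)] Cons.prems(3) by auto
  then obtain e' q' where q: "q = e' # q'" by (cases q) auto
  obtain w' where e': "e' = (x, w')" using Cons.prems(3) q by (cases e') auto
  have "w = w'" using assms(1) Cons.prems e e' q unfolding single_valued_def by auto
  then show ?case using Cons e e' q by auto
qed

lemma directed_pathD:
  assumes "directed_path G"
  shows directed_path_pair_digraph: "pair_digraph G"
    and directed_path_antiparallel_free: "(x, y) \<in> parcs G \<Longrightarrow> (y, x) \<notin> parcs G"
    and directed_path_connected: "Digraph_Component.connected (with_proj G)"
    and directed_path_single_valued: "single_valued (parcs G)"
    and directed_path_single_valued_converse: "single_valued ((parcs G)\<inverse>)"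
proof -
  show G: "pair_digraph G" "(x, y) \<in> parcs G \<Longrightarrow> (y, x) \<notin> parcs G"
    "Digraph_Component.connected (with_proj G)"
    using assms by (auto simp: directed_path_def oriented_tree_def)
  interpret pair_digraph G by (rule G)
  have deg: "card (out_arcs (with_proj G) v) \<le> 1" "card (in_arcs (with_proj G) v) \<le> 1"
    if "v \<in> pverts G" for v
    using assms that by (auto simp: directed_path_def out_degree_def in_degree_def)
  have fin: "finite (out_arcs (with_proj G) v)" "finite (in_arcs (with_proj G) v)" for v by auto
  show "single_valued (parcs G)"
  proof (rule single_valuedI)
    fix a b c assume "(a, b) \<in> parcs G" "(a, c) \<in> parcs G"
    moreover from this have "a \<in> pverts G" by (auto intro: in_arcsD1)
    ultimately have "(a, b) = (a, c)"
      using deg(1)[of a] card_le_Suc0_iff_eq[OF fin(1)[of a]] by force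
    then show "b = c" by simp
  qed
  show "single_valued ((parcs G)\<inverse>)"
  proof (rule single_valuedI)
    fix a b c assume "(a, b) \<in> (parcs G)\<inverse>" "(a, c) \<in> (parcs G)\<inverse>"
    moreover from this have "a \<in> pverts G" by (auto intro: in_arcsD2)
    ultimately have "(b, a) = (c, a)"
      using deg(2)[of a] card_le_Suc0_iff_eq[OF fin(2)[of a]] by force
    then show "b = c" by simp
  qed
qed

text \<open>
  The function \<open>h\<close> places the vertices on the real line. The path from \<open>x\<close> to \<open>y\<close> goes either only
  forwards, and then its length telescopes to \<open>h y - h x\<close>, or only backwards, and then it has no
  forward edge. Applying the lemmas about increasing walks to the reversed arcs and \<open>- h\<close> covers the second
  case, in particular in showing that the path is unique.
\<close>

lemma tree_dist_directed_path:
  fixes h :: "'v \<Rightarrow> real"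
  assumes G: "directed_path G"
    and \<alpha>: "\<forall>e\<in>parcs G. 0 < \<alpha> e"
    and h: "\<forall>(a, b)\<in>parcs G. h b = h a + \<alpha> (a, b)"
    and xy: "x \<in> pverts G" "y \<in> pverts G"
  shows "tree_dist G \<alpha> x y = max 0 (h y - h x)"
proof -
  interpret pair_digraph G using G by (rule directed_path_pair_digraph)
  interpret U: pair_wf_digraph "mk_symmetric (with_proj G)" by (rule wellformed_mk_symmetric)
  let ?E = "parcs G"
  have sv: "single_valued ?E" "single_valued (?E\<inverse>)"
    using G by (simp_all add: directed_path_single_valued directed_path_single_valued_converse)
  have up: "\<forall>(a, b)\<in>?E. h a < h b" using h \<alpha> by fastforce
  have down: "\<forall>(a, b)\<in>?E\<inverse>. - h a < - h b" using up by auto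
  have mono: "set p \<subseteq> ?E \<and> (p \<noteq> [] \<longrightarrow> h x < h y) \<or> set p \<subseteq> ?E\<inverse> \<and> (p \<noteq> [] \<longrightarrow> h y < h x)"
    if "U.apath x p y" for p
  proof -
    have p: "set p \<subseteq> ?E \<union> ?E\<inverse>" "pcas x p y" "distinct (pawalk_verts x p)"
      using that by (auto simp: apath_underlying_iff)
    show ?thesis
      using path_in_deg_one_relation_monotone[OF sv p(2,1,3)]
        walk_increases[OF up p(2)] walk_increases[OF down p(2)] by auto
  qed
  have "\<exists>p. U.apath x p y"
  proof -
    have "x \<rightarrow>\<^sup>*\<^bsub>with_proj (mk_symmetric (with_proj G))\<^esub> y"
      using directed_path_connected[OF G] xy
      by (auto simp: Digraph_Component.connected_def strongly_connected_def)
    then obtain w where "U.awalk x w y" using U.reachable_awalk by auto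
    then show ?thesis using U.apath_awalk_to_apath by metis
  qed
  then obtain p where p: "U.apath x p y" by blast
  have "q = p" if q: "U.apath x q y" for q
  proof -
    have "pcas x p y" "pcas x q y" using p q by (auto simp: apath_underlying_iff)
    then show ?thesis
      using mono[OF p] mono[OF q] walk_unique[OF sv(1) up, of x q y p]
        walk_unique[OF sv(2) down, of x q y p] by fastforce
  qed
  then have path: "undirected_path G x y = p"
    unfolding undirected_path_def using p by (intro the_equality)
  have pcas: "pcas x p y" using p by (simp add: apath_underlying_iff)
  have "distinct p"
    using p U.distinct_verts_imp_distinct unfolding U.apath_def by blast
  have dist: "tree_dist G \<alpha> x y = sum \<alpha> (set p \<inter> ?E)"
    by (simp add: tree_dist_def forward_edges_def path)
  from mono[OF p] show ?thesis
  proof (elim disjE conjE)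
    assume E: "set p \<subseteq> ?E" and le: "p \<noteq> [] \<longrightarrow> h x < h y"
    have "tree_dist G \<alpha> x y = sum \<alpha> (set p)"
      using E by (simp add: dist Int_absorb2)
    also have "\<dots> = h y - h x"
      using walk_telescopes[OF h pcas E] \<open>distinct p\<close> by (simp add: sum_list_distinct_conv_sum_set)
    finally show ?thesis using le pcas by (cases "p = []") auto
  next
    assume E: "set p \<subseteq> ?E\<inverse>" and le: "p \<noteq> [] \<longrightarrow> h y < h x"
    have "set p \<inter> ?E = {}" using E directed_path_antiparallel_free[OF G] by fastforce
    then show ?thesis using le pcas dist by (cases "p = []") auto
  qed
qed

text \<open>The nearest vertices are the last one of \<open>F\<close> and the first one of \<open>F'\<close>.\<close>

lemma subtree_dist_directed_path:
  fixes h :: "'v \<Rightarrow> real"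
  assumes G: "directed_path G"
    and \<alpha>: "\<forall>e\<in>parcs G. 0 < \<alpha> e"
    and h: "\<forall>(a, b)\<in>parcs G. h b = h a + \<alpha> (a, b)"
    and F: "subtree F G" "subtree F' G"
  shows "subtree_dist G \<alpha> F F' = max 0 (Min (h ` pverts F') - Max (h ` pverts F))"
proof -
  interpret pair_digraph G using G by (rule directed_path_pair_digraph)
  have sub: "pverts F \<subseteq> pverts G" "pverts F' \<subseteq> pverts G"
    and ne: "pverts F \<noteq> {}" "pverts F' \<noteq> {}"
    using F by (auto simp: subtree_def subgraph_def Digraph_Component.connected_def strongly_connected_def)
  have fin: "finite (pverts F)" "finite (pverts F')"
    using sub finite_subset pair_finite_verts by blast+
  let ?D = "{tree_dist G \<alpha> x y | x y. x \<in> pverts F \<and> y \<in> pverts F'}"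
  have dist: "tree_dist G \<alpha> x y = max 0 (h y - h x)" if "x \<in> pverts F" "y \<in> pverts F'" for x y
    using tree_dist_directed_path[OF G \<alpha> h] that sub by blast
  have "?D = (\<lambda>(x, y). tree_dist G \<alpha> x y) ` (pverts F \<times> pverts F')" by auto
  then have "finite ?D" using fin by simp
  moreover have "Max (h ` pverts F) \<in> h ` pverts F" using fin ne by (intro Max_in) auto
  then obtain x where x: "x \<in> pverts F" "h x = Max (h ` pverts F)" by force
  moreover have "Min (h ` pverts F') \<in> h ` pverts F'" using fin ne by (intro Min_in) auto
  then obtain y where y: "y \<in> pverts F'" "h y = Min (h ` pverts F')" by force
  have "max 0 (Min (h ` pverts F') - Max (h ` pverts F)) \<in> ?D"
    using dist[OF x(1) y(1)] x y by (metis (mono_tags, lifting) mem_Collect_eq)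
  moreover have "max 0 (Min (h ` pverts F') - Max (h ` pverts F)) \<le> d" if d_in: "d \<in> ?D" for d
  proof -
    obtain x' y' where d: "d = tree_dist G \<alpha> x' y'" "x' \<in> pverts F" "y' \<in> pverts F'"
      using d_in by auto
    have "Min (h ` pverts F') \<le> h y'" "h x' \<le> Max (h ` pverts F)" using d fin by auto
    then show ?thesis using d dist by auto
  qed
  ultimately show ?thesis unfolding subtree_dist_def by (intro Min_eqI) auto
qed

text \<open>
  A shortest closed directed walk is a cycle of the underlying graph. Length one would make it a
  loop and length two a pair of antiparallel arcs, neither of which exists, and cycles of length at
  least three are excluded in a tree.
\<close>

lemma acyclic_oriented_tree:
  assumes "oriented_tree G"
  shows "acyclic (parcs G)"
proof (rule acyclicI, intro allI notI)
  fix x assume x: "(x, x) \<in> (parcs G)\<^sup>+"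
  have anti: "\<And>x y. (x, y) \<in> parcs G \<Longrightarrow> (y, x) \<notin> parcs G"
    and no_cycle: "\<And>p. pre_digraph.cycle (with_proj (mk_symmetric (with_proj G))) p \<Longrightarrow> length p < 3"
    using assms by (auto simp: oriented_tree_def not_le[symmetric])
  interpret pair_digraph G using assms by (simp add: oriented_tree_def)
  obtain w where "awalk x w x" "w \<noteq> []" using x reachable1_awalk by auto
  then have "closed_w w" by (auto simp: closed_w_def)
  then obtain p where cycle: "cycle p" using closed_w_imp_cycle by blast
  obtain u where p: "u \<in> pverts G" "set p \<subseteq> parcs G" "pcas u p u"
    "distinct (tl (pawalk_verts u p))" "p \<noteq> []"
    using cycle[unfolded cycle_with_proj_iff] by blast
  then have "pre_digraph.cycle (with_proj (mk_symmetric (with_proj G))) p"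
    by (auto simp: cycle_with_proj_iff parcs_underlying)
  then have "length p < 3" by (rule no_cycle)
  moreover obtain e q where e: "p = e # q" using p(5) by (cases p) auto
  ultimately consider "q = []" | e' where "q = [e']" by (cases q) auto
  then show False
  proof cases
    case 1
    then show False using p(2,3) e anti by (cases e) auto
  next
    case 2
    then show False using p(2,3) e anti by (cases e; cases e') auto
  qed
qed

text \<open>
  The height of \<open>v\<close> is the total length of the arcs in \<open>B v\<close>, those from whose head \<open>v\<close> can be
  reached. Passing from \<open>a\<close> to \<open>b\<close> along an arc adds exactly this arc to the set: it is the only
  arc into \<open>b\<close>, and acyclicity keeps it out of \<open>B a\<close>.
\<close>

lemma directed_path_height_exists:
  fixes \<alpha> :: "'v \<times> 'v \<Rightarrow> real"
  assumes G: "directed_path G"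
  obtains h :: "'v \<Rightarrow> real" where "\<forall>(a, b)\<in>parcs G. h b = h a + \<alpha> (a, b)"
proof -
  interpret pair_digraph G using G by (rule directed_path_pair_digraph)
  let ?E = "parcs G"
  define B where "B v = {e \<in> ?E. (snd e, v) \<in> ?E\<^sup>*}" for v
  have acyc: "acyclic ?E" using G by (simp add: directed_path_def acyclic_oriented_tree)
  have "sum \<alpha> (B b) = sum \<alpha> (B a) + \<alpha> (a, b)" if ab: "(a, b) \<in> ?E" for a b
  proof -
    have "B b = insert (a, b) (B a)"
    proof (rule set_eqI, rule iffI)
      fix e assume "e \<in> B b"
      then have e: "e \<in> ?E" "(snd e, b) \<in> ?E\<^sup>*" by (auto simp: B_def)
      from e(2) show "e \<in> insert (a, b) (B a)"
      proof (cases rule: rtranclE)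
        case base
        then have "e = (a, b)"
          using e(1) ab directed_path_single_valued_converse[OF G]
          by (cases e) (auto dest: single_valuedD)
        then show ?thesis by simp
      next
        case (step c)
        then have "c = a"
          using ab directed_path_single_valued_converse[OF G] by (auto dest: single_valuedD)
        then show ?thesis using step e(1) by (simp add: B_def)
      qed
    next
      fix e assume "e \<in> insert (a, b) (B a)"
      then show "e \<in> B b" using ab by (auto simp: B_def intro: rtrancl_into_rtrancl)
    qed
    moreover have "(a, b) \<notin> B a"
      using acyc ab by (auto simp: B_def acyclic_def dest: rtrancl_into_trancl2)
    moreover have "finite (B a)" using pair_finite_arcs by (simp add: B_def)
    ultimately show ?thesis by simp
  qed
  then show thesis using that[of "\<lambda>v. sum \<alpha> (B v)"] by blast
qed

definition interval_path :: "nat \<Rightarrow> nat \<Rightarrow> nat pair_pre_digraph" where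
  "interval_path l m = \<lparr> pverts = {l..<m}, parcs = {(i, Suc i) | i. l \<le> i \<and> Suc i < m} \<rparr>"

lemma interval_path_simps [simp]:
  "pverts (interval_path l m) = {l..<m}"
  "(a, b) \<in> parcs (interval_path l m) \<longleftrightarrow> l \<le> a \<and> b = Suc a \<and> b < m"
  by (auto simp: interval_path_def)

lemma pair_digraph_interval_path: "pair_digraph (interval_path l m)"
proof unfold_locales
  show "finite (parcs (interval_path l m))"
    by (rule finite_subset[of _ "{l..<m} \<times> {l..<m}"]) auto
qed (auto simp: interval_path_def)

lemma connected_interval_path:
  assumes "l < m"
  shows "Digraph_Component.connected (with_proj (interval_path l m))"
proof -
  let ?G = "interval_path l m"
  interpret pair_digraph ?G by (rule pair_digraph_interval_path)
  have up: "i \<rightarrow>\<^sup>*\<^bsub>with_proj (mk_symmetric (with_proj ?G))\<^esub> j"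
    if "l \<le> i" "i \<le> j" "j < m" for i j
  proof -
    have "(i, j) \<in> (parcs ?G)\<^sup>*"
      using that(2,3)
    proof (induction j rule: dec_induct)
      case (step k)
      then have "(k, Suc k) \<in> parcs ?G" using that(1) by simp
      then show ?case using step by (auto intro: rtrancl_into_rtrancl)
    qed simp
    then have "i \<rightarrow>\<^sup>*\<^bsub>with_proj ?G\<^esub> j" using that by (simp add: reachable_conv)
    then show ?thesis by (rule reachable_mk_symmetricI)
  qed
  have "i \<rightarrow>\<^sup>*\<^bsub>with_proj (mk_symmetric (with_proj ?G))\<^esub> j"
    if "l \<le> i" "i < m" "l \<le> j" "j < m" for i j
    using up[of i j] up[of j i] symmetric_reachable[OF symmetric_mk_symmetric, of "with_proj ?G" j i] that
    by (cases "i \<le> j") auto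
  then show ?thesis
    using assms by (auto simp: Digraph_Component.connected_def strongly_connected_def)
qed

lemma walk_in_successor_relation:
  assumes "pcas x p y" "set p \<subseteq> {(i, Suc i) | i. True}"
  shows "y = x + length p"
  using assms
proof (induction p arbitrary: x)
  case (Cons e p)
  then have "e = (x, Suc x)" by auto
  then show ?case using Cons.IH[of "Suc x"] Cons.prems by auto
qed simp

lemma walk_in_predecessor_relation:
  assumes "pcas x p y" "set p \<subseteq> {(Suc i, i) | i. True}"
  shows "x = y + length p"
  using assms
proof (induction p arbitrary: x)
  case (Cons e p)
  then obtain i where "e = (Suc i, i)" "x = Suc i" by auto
  then show ?case using Cons.IH[of i] Cons.prems by auto
qed simp

text \<open>
  For acyclicity, remove the first edge from a cycle of the underlying graph. The rest is a path
  between two consecutive numbers that moves always up or always down, so it has length one.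
\<close>

lemma directed_path_interval_path:
  assumes "l < m"
  shows "directed_path (interval_path l m)"
proof -
  let ?G = "interval_path l m"
  let ?E = "parcs ?G"
  interpret pair_digraph ?G by (rule pair_digraph_interval_path)
  have sv: "single_valued ?E" "single_valued (?E\<inverse>)" by (auto simp: single_valued_def)
  have "length p < 3" if cycle: "pre_digraph.cycle (with_proj (mk_symmetric (with_proj ?G))) p" for p
  proof -
    obtain u where u: "set p \<subseteq> ?E \<union> ?E\<inverse>" "pcas u p u" "distinct (tl (pawalk_verts u p))" "p \<noteq> []"
      using cycle by (auto simp: cycle_with_proj_iff parcs_underlying)
    obtain e q where p: "p = e # q" using u(4) by (cases p) auto
    obtain w where e: "e = (u, w)" using u(2) p by (cases e) auto
    have q: "pcas w q u" "set q \<subseteq> ?E \<union> ?E\<inverse>" "distinct (pawalk_verts w q)" using u p e by auto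
    have "set q \<subseteq> ?E \<or> set q \<subseteq> ?E\<inverse>"
      by (rule path_in_deg_one_relation_monotone[OF sv q])
    moreover have "?E \<subseteq> {(i, Suc i) | i. True}" "?E\<inverse> \<subseteq> {(Suc i, i) | i. True}" by auto
    ultimately have "u = w + length q \<or> w = u + length q"
      using walk_in_successor_relation[OF q(1)] walk_in_predecessor_relation[OF q(1)] by blast
    moreover have "w = Suc u \<or> u = Suc w" using u(1) p e by auto
    ultimately show ?thesis using p by auto
  qed
  then have "oriented_tree ?G"
    using connected_interval_path[OF assms] pair_digraph_interval_path
    by (fastforce simp: oriented_tree_def)
  moreover have "out_degree (with_proj ?G) v \<le> 1 \<and> in_degree (with_proj ?G) v \<le> 1" for v
    unfolding out_degree_def in_degree_def One_nat_def
    by (subst (1 2) card_le_Suc0_iff_eq) auto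
  ultimately show ?thesis by (simp add: directed_path_def)
qed

lemma subtree_interval_path:
  assumes "l \<le> i" "i < j" "j \<le> m"
  shows "subtree (interval_path i j) (interval_path l m)"
proof -
  have "wf_digraph (with_proj (interval_path i j))" for i j
    unfolding wf_digraph_wp_iff
    using pair_digraph.pair_wf_digraph[OF pair_digraph_interval_path] .
  then show ?thesis
    using assms connected_interval_path[of i j]
    by (auto simp: subtree_def subgraph_def compatible_def)
qed

lemma directed_path_realization_imp_intervals:
  assumes G: "directed_path \<Gamma>" and real: "oriented_tree_realization S \<mu> \<Gamma> \<alpha> F"
  shows "\<exists>a b. \<forall>s\<in>S. \<forall>t\<in>S. \<mu> s t = max 0 (a t - b s :: real)"
proof -
  obtain h :: "'a \<Rightarrow> real" where h: "\<forall>(a, b)\<in>parcs \<Gamma>. h b = h a + \<alpha> (a, b)"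
    using directed_path_height_exists[OF G] by blast
  have "\<mu> s t = max 0 (Min (h ` pverts (F t)) - Max (h ` pverts (F s)))" if "s \<in> S" "t \<in> S" for s t
    using real that subtree_dist_directed_path[OF G _ h, of "F s" "F t"]
    by (simp add: oriented_tree_realization_def)
  then show ?thesis
    by (intro exI[of _ "\<lambda>t. Min (h ` pverts (F t))"] exI[of _ "\<lambda>s. Max (h ` pverts (F s))"]) simp
qed

text \<open>
  The vertices of the path are the positions in the sorted list of all end points, each edge has the
  length of the corresponding gap, and \<open>s\<close> is assigned the vertices from its left to its right
  end point.
\<close>

lemma intervals_imp_directed_path_realization:
  fixes a b :: "'s \<Rightarrow> real"
  assumes "finite S" and ab: "\<And>s. s \<in> S \<Longrightarrow> a s \<le> b s"
    and \<mu>: "\<And>s t. s \<in> S \<Longrightarrow> t \<in> S \<Longrightarrow> \<mu> s t = max 0 (a t - b s)"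
  shows "\<exists>(\<Gamma> :: nat pair_pre_digraph) \<alpha> F.
    oriented_tree_realization S \<mu> \<Gamma> \<alpha> F \<and> directed_path \<Gamma>"
proof -
  \<comment> \<open>The extra point \<open>0\<close> provides a vertex in case \<open>S\<close> is empty.\<close>
  define zs where "zs = sorted_list_of_set (insert 0 (a ` S \<union> b ` S))"
  define n where "n = length zs"
  have set_zs: "set zs = insert 0 (a ` S \<union> b ` S)" 
    unfolding zs_def by (rule set_sorted_list_of_set) (simp add: \<open>finite S\<close>)
  have strict: "sorted_wrt (<) zs" unfolding zs_def by (rule strict_sorted_list_of_set)
  have less: "zs ! i < zs ! j" if "i < j" "j < n" for i j
    using strict that by (simp add: n_def sorted_wrt_iff_nth_less)
  have le: "zs ! i \<le> zs ! j" if "i \<le> j" "j < n" for i j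
    using less[of i j] that by (cases "i = j") auto
  have "0 < n" unfolding n_def using set_zs by (cases zs) auto
  have "\<exists>i<n. zs ! i = a s" "\<exists>i<n. zs ! i = b s" if "s \<in> S" for s
    using set_zs that unfolding n_def by (simp_all add: in_set_conv_nth[symmetric])
  then obtain l m where l: "\<And>s. s \<in> S \<Longrightarrow> l s < n \<and> zs ! l s = a s"
    and m: "\<And>s. s \<in> S \<Longrightarrow> m s < n \<and> zs ! m s = b s"
    by metis
  have lm: "l s \<le> m s" if "s \<in> S" for s
    using less[of "m s" "l s"] l[OF that] m[OF that] ab[OF that] by (force simp: not_le[symmetric])
  let ?\<Gamma> = "interval_path 0 n"
  let ?F = "\<lambda>s. interval_path (l s) (Suc (m s))"
  let ?\<alpha> = "\<lambda>e. zs ! snd e - zs ! fst e"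
  have path: "directed_path ?\<Gamma>" using \<open>0 < n\<close> by (rule directed_path_interval_path)
  have pos: "0 < ?\<alpha> e" if "e \<in> parcs ?\<Gamma>" for e using that less by (cases e) auto
  have sub: "subtree (?F s) ?\<Gamma>" if "s \<in> S" for s
    using lm[OF that] m[OF that] by (intro subtree_interval_path) auto
  have "Min ((!) zs ` pverts (?F s)) = a s" "Max ((!) zs ` pverts (?F s)) = b s" if s: "s \<in> S" for s
  proof -
    have bounds: "a s \<le> zs ! i \<and> zs ! i \<le> b s" if "i \<in> {l s..<Suc (m s)}" for i
      using that l[OF s] m[OF s] le[of "l s" i] le[of i "m s"] by auto
    have ends: "l s \<in> {l s..<Suc (m s)}" "m s \<in> {l s..<Suc (m s)}" using lm[OF s] by auto
    show "Min ((!) zs ` pverts (?F s)) = a s"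
      using bounds imageI[OF ends(1), of "(!) zs"] l[OF s] by (intro Min_eqI) auto
    show "Max ((!) zs ` pverts (?F s)) = b s"
      using bounds imageI[OF ends(2), of "(!) zs"] m[OF s] by (intro Max_eqI) auto
  qed
  moreover have "subtree_dist ?\<Gamma> ?\<alpha> (?F s) (?F t) =
      max 0 (Min ((!) zs ` pverts (?F t)) - Max ((!) zs ` pverts (?F s)))"
    if "s \<in> S" "t \<in> S" for s t
    using path pos sub[OF that(1)] sub[OF that(2)] by (intro subtree_dist_directed_path) auto
  ultimately have "oriented_tree_realization S \<mu> ?\<Gamma> ?\<alpha> ?F"
    using path pos sub \<mu> by (auto simp: oriented_tree_realization_def directed_path_def)
  then show ?thesis using path by blast
qed

section \<open>The three equivalent conditions\<close>

text \<open>
  That the intervals are nonempty, \<open>a s \<le> b s\<close>, is what \<open>\<mu> s s = 0\<close> says about their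
  representation of \<open>\<mu>\<close>.
\<close>

lemma directed_path_realization_iff_positive_crossing:
  assumes "finite S" and dd: "directed_distance_on S \<mu>"
  shows "(\<exists>(\<Gamma> :: nat pair_pre_digraph) \<alpha> F.
      oriented_tree_realization S \<mu> \<Gamma> \<alpha> F \<and> directed_path \<Gamma>) \<longleftrightarrow> positive_crossing S \<mu>"
proof
  assume "\<exists>(\<Gamma> :: nat pair_pre_digraph) \<alpha> F.
      oriented_tree_realization S \<mu> \<Gamma> \<alpha> F \<and> directed_path \<Gamma>"
  then obtain \<Gamma> :: "nat pair_pre_digraph" and \<alpha> F
    where "directed_path \<Gamma>" "oriented_tree_realization S \<mu> \<Gamma> \<alpha> F" by blast
  from directed_path_realization_imp_intervals[OF this] show "positive_crossing S \<mu>"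
    by (elim exE) (rule positive_crossing_if_intervals)
next
  assume "positive_crossing S \<mu>"
  then obtain a b where ab: "\<And>s t. s \<in> S \<Longrightarrow> t \<in> S \<Longrightarrow> \<mu> s t = max 0 (a t - b s)"
    using intervals_if_positive_crossing[OF assms] by blast
  have "a s \<le> b s" if "s \<in> S" for s
  proof -
    have "max 0 (a s - b s) = 0"
      using ab[OF that that] dd that by (simp add: directed_distance_on_def)
    then show ?thesis by (simp add: max_def split: if_splits)
  qed
  from \<open>finite S\<close> this ab show "\<exists>(\<Gamma> :: nat pair_pre_digraph) \<alpha> F.
      oriented_tree_realization S \<mu> \<Gamma> \<alpha> F \<and> directed_path \<Gamma>"
    by (rule intervals_imp_directed_path_realization)
qed

theorem theorem3p1:
  fixes S :: "'s::finite set" and \<mu> :: "'s \<Rightarrow> 's \<Rightarrow> real"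
  assumes "directed_distance_on S \<mu>"
  shows
    "((\<exists>(\<Gamma> :: nat pair_pre_digraph) \<alpha> F.
          oriented_tree_realization S \<mu> \<Gamma> \<alpha> F \<and> directed_path \<Gamma>)
        \<longleftrightarrow> dim_directed_tight_span S \<mu> \<le> 1)
     \<and>
     (dim_directed_tight_span S \<mu> \<le> 1
        \<longleftrightarrow> (\<forall>s\<in>S. \<forall>t\<in>S. \<forall>u\<in>S. \<forall>v\<in>S.
               \<mu> s u + \<mu> t v \<le> Max {\<mu> s v + \<mu> t u, \<mu> s u, \<mu> s v, \<mu> t u, \<mu> t v}))"
  using directed_path_realization_iff_positive_crossing[OF finite assms]
    dim_tight_span_le_one_iff[OF assms] positive_crossing_iff_four_point[OF assms]
  by simp

end
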